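(* Let $G$ be a hypergraph on $[n]$ and let $P_G=\sum_{U\in G}\Delta_U\subset\mathbb R^n$ be its hypergraphic polytope. Then the cones of the normal fan $\mathcal N(P_G)$ in $(\mathbb R^n)^*$ are exactly the cones $C_{\mathcal O}$ where $\mathcal O$ runs over the disjoint union $\mathcal{AO}=\bigsqcup_{F\in Flats(G)}\mathfrak O(G/F)$, distinct elements of $\mathcal{AO}$ giving distinct cones. In particular, the faces of $P_G$ are in one-to-one correspondence with the elements of $\mathcal{AO}$ (the face corresponding to $\mathcal O$ being the one with normal cone $C_{\mathcal O}$).
   Context: A hypergraph on $[n]$ is a set $G$ of subsets of $[n]$ each of size at least $2$. For $K\subseteq[n]$, $G|_K=\{U\in G:U\subseteq K\}$; for a set composition $A=(A_1,\dots,A_k)$ of $[n]$ (sequence of nonempty pairwise disjoint sets with union $[n]$), $G|_A=\bigcup_i G|_{A_i}$; these are the flats, $Flats(G)=\{G|_A\}$. For a flat $F$, $[n]/F$ is the partition of $[n]$ into connected components of $([n],F)$, and $G/F$ is the hypergraph on vertex set $[n]/F$ with hyperedges indexed by $U\in G\setminus F$, the hyperedge $\bar U$ being the set of blocks meeting $U$. An orientation $\mathcal O$ of $G/F$ chooses for each $\bar U$ an ordered pair $(\mathfrak a_U,\mathfrak b_U)$ of nonempty disjoint sets with union $\bar U$ (head $\mathfrak a_U$). $[n]/\mathcal O$ is the finest partition of $[n]$ coarser than $[n]/F$ in which all blocks of each head lie in a common part. $(G/F)/\mathcal O$ is the directed multigraph on the parts of $[n]/\mathcal O$ with, for every $U$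 and every block $\beta\in\mathfrak b_U$, an arrow from the part containing $\mathfrak a_U$ to the part containing $\beta$ (loops allowed). $\mathcal O$ is acyclic if $(G/F)/\mathcal O$ has no directed cycle (loops count); $\mathfrak O(G/F)$ is the set of acyclic orientations. For $\mathcal O\in\mathfrak O(G/F)$, $C_{\mathcal O}=\{\mathbf x\in(\mathbb R^n)^*: x_a=x_b \text{ if } a,b \text{ lie in the same part of } [n]/\mathcal O;\ x_a\ge x_b \text{ if there is an arrow from the part of } a \text{ to the part of } b \text{ in } (G/F)/\mathcal O\}$, where $x_i=\mathbf x(e_i)$. For $U\subseteq[n]$, $\Delta_U$ is the convex hull of $\{e_i: i\in U\}$, $e_i$ the standard basis vectors, and the sum is Minkowski sum. The normal fan of a polytope $P$ consists, for each nonempty face $f$, of the cone of linear functionals whose maximum on $P$ is attained on all of $f$. *)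

theory Defs
  imports
    "HOL-Analysis.Analysis"
    "HOL-Library.Disjoint_Sets"
    "Graph_Theory.Arc_Walk"
begin

text \<open>The vertex set $[n]$ is the universe of a finite type \<open>'n\<close>, so that $n$ is \<open>CARD('n)\<close>.\<close>

definition hypergraph :: "'n::finite set set \<Rightarrow> bool" where
  "hypergraph G \<longleftrightarrow> (\<forall>U\<in>G. card U \<ge> 2)"

definition hrestrict :: "'n set set \<Rightarrow> 'n set \<Rightarrow> 'n set set" where
  "hrestrict G K = {U \<in> G. U \<subseteq> K}"

definition set_composition :: "'n set list \<Rightarrow> bool" where
  "set_composition A \<longleftrightarrow> distinct A \<and> partition_on UNIV (set A)"

definition Flats :: "'n set set \<Rightarrow> 'n set set set" where
  "Flats G = {\<Union>K\<in>set A. hrestrict G K | A. set_composition A}"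

definition hcomponents :: "'n set set \<Rightarrow> 'n set set" where
  "hcomponents F = UNIV // ({(a, b). \<exists>U\<in>F. a \<in> U \<and> b \<in> U}\<^sup>*)"

text \<open>
  The hyperedge $\bar U$ of $G/F$. Distinct \<open>U\<close> may have equal $\bar U$; they remain distinct
  hyperedges because orientations below are indexed by \<open>U \<in> G - F\<close>.
\<close>

definition contract_edge :: "'n set set \<Rightarrow> 'n set \<Rightarrow> 'n set set" where
  "contract_edge F U = {\<beta> \<in> hcomponents F. \<beta> \<inter> U \<noteq> {}}"

text \<open>
  An orientation sends \<open>U\<close> to the pair $(\mathfrak a_U, \mathfrak b_U)$. It is extensional
  (\<open>undefined\<close> off \<open>G - F\<close>), so two orientations are equal iff they make the same choices.
\<close>

type_synonym 'n orientation = "'n set \<Rightarrow> 'n set set \<times> 'n set set"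

definition orientations :: "'n set set \<Rightarrow> 'n set set \<Rightarrow> 'n orientation set" where
  "orientations G F =
     (\<Pi>\<^sub>E U\<in>G - F. {(a, b). a \<noteq> {} \<and> b \<noteq> {} \<and> a \<inter> b = {} \<and> a \<union> b = contract_edge F U})"

definition merges_heads ::
    "'n set set \<Rightarrow> 'n set set \<Rightarrow> 'n orientation \<Rightarrow> 'n set set \<Rightarrow> bool" where
  "merges_heads G F Or P \<longleftrightarrow>
     refines UNIV (hcomponents F) P \<and> (\<forall>U\<in>G - F. \<exists>p\<in>P. \<forall>\<beta>\<in>fst (Or U). \<beta> \<subseteq> p)"

text \<open>The partition $[n]/\mathcal O$.\<close>

definition parts :: "'n set set \<Rightarrow> 'n set set \<Rightarrow> 'n orientation \<Rightarrow> 'n set set" where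
  "parts G F Or =
     (THE P. merges_heads G F Or P \<and> (\<forall>Q. merges_heads G F Or Q \<longrightarrow> refines UNIV P Q))"

text \<open>
  The directed multigraph $(G/F)/\mathcal O$. Its arrows are the pairs \<open>(U, \<beta>)\<close> with
  $\beta \in \mathfrak b_U$. An arrow starts at the part of the head $\mathfrak a_U$ of the
  hyperedge, so the head of a hyperedge lies at the \<open>tail\<close> (source) end of its arrows.
\<close>

definition orientation_digraph ::
    "'n set set \<Rightarrow> 'n set set \<Rightarrow> 'n orientation \<Rightarrow> ('n set, 'n set \<times> 'n set) pre_digraph" where
  "orientation_digraph G F Or =
     \<lparr> verts = parts G F Or,
       arcs = {(U, \<beta>). U \<in> G - F \<and> \<beta> \<in> snd (Or U)},
       tail = (\<lambda>(U, \<beta>). THE p. p \<in> parts G F Or \<and> \<Union>(fst (Or U)) \<subseteq> p),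
       head = (\<lambda>(U, \<beta>). THE p. p \<in> parts G F Or \<and> \<beta> \<subseteq> p) \<rparr>"

text \<open>A loop is a \<open>pre_digraph.cycle\<close> of length one.\<close>

definition acyclic_orientations :: "'n set set \<Rightarrow> 'n set set \<Rightarrow> 'n orientation set" where
  "acyclic_orientations G F =
     {Or \<in> orientations G F. \<nexists>c. pre_digraph.cycle (orientation_digraph G F Or) c}"

definition AO :: "'n set set \<Rightarrow> ('n set set \<times> 'n orientation) set" where
  "AO G = (SIGMA F:Flats G. acyclic_orientations G F)"

definition orientation_cone ::
    "'n::finite set set \<Rightarrow> 'n set set \<Rightarrow> 'n orientation \<Rightarrow> (real ^ 'n \<Rightarrow> real) set" where
  "orientation_cone G F Or =
     {x. linear x \<and>
         (\<forall>p\<in>parts G F Or. \<forall>a\<in>p. \<forall>b\<in>p. x (axis a 1) = x (axis b 1)) \<and>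
         (\<forall>e\<in>arcs (orientation_digraph G F Or).
            \<forall>a\<in>tail (orientation_digraph G F Or) e. \<forall>b\<in>head (orientation_digraph G F Or) e.
              x (axis a 1) \<ge> x (axis b 1))}"

definition simplex_of :: "'n::finite set \<Rightarrow> (real ^ 'n) set" where
  "simplex_of U = convex hull ((\<lambda>i. axis i 1) ` U)"

text \<open>
  The sum is the Minkowski sum of \<^theory>\<open>HOL-Library.Set_Algebras\<close>; it is \<open>{0}\<close> if \<open>G\<close> is empty.
\<close>

definition hypergraphic_polytope :: "'n::finite set set \<Rightarrow> (real ^ 'n) set" where
  "hypergraphic_polytope G = (\<Sum>U\<in>G. simplex_of U)"

definition nonempty_faces :: "'a::real_vector set \<Rightarrow> 'a set set" where
  "nonempty_faces P = {f. f face_of P \<and> f \<noteq> {}}"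

definition normal_cone :: "'a::real_vector set \<Rightarrow> 'a set \<Rightarrow> ('a \<Rightarrow> real) set" where
  "normal_cone P f = {x. linear x \<and> (\<forall>u\<in>f. \<forall>v\<in>P. x v \<le> x u)}"

definition normal_fan :: "'a::real_vector set \<Rightarrow> ('a \<Rightarrow> real) set set" where
  "normal_fan P = normal_cone P ` nonempty_faces P"

text \<open>The definite descriptions above are proper.\<close>

lemma partition_on_hcomponents: "partition_on UNIV (hcomponents F)"
proof -
  have "sym {(a, b). \<exists>U\<in>F. a \<in> U \<and> b \<in> U}"
    by (auto simp: sym_def)
  then have "equiv UNIV ({(a, b). \<exists>U\<in>F. a \<in> U \<and> b \<in> U}\<^sup>*)"
    by (intro equivI refl_rtrancl trans_rtrancl sym_rtrancl) auto
  then show ?thesis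
    unfolding hcomponents_def by (rule partition_on_quotient)
qed

lemma parts_ex1:
  fixes G :: "'n set set"
  shows "\<exists>!P. merges_heads G F Or P \<and> (\<forall>Q. merges_heads G F Or Q \<longrightarrow> refines UNIV P Q)"
proof (rule ex_ex1I)
  let ?M = "{P. merges_heads G F Or P}"
  let ?R = "common_refinement ?M"
  have "merges_heads G F Or {UNIV}"
    unfolding merges_heads_def refines_def
    using partition_on_hcomponents by (auto simp: partition_on_def)
  then have ne: "?M \<noteq> {}" by blast
  have part: "partition_on UNIV P" if "P \<in> ?M" for P
    using that by (auto simp: merges_heads_def refines_def)
  have partR: "partition_on UNIV ?R"
    by (rule partition_on_common_refinement[OF part ne])
  have in_part: "\<exists>p\<in>?R. X \<subseteq> p" if X: "\<And>P. P \<in> ?M \<Longrightarrow> \<exists>p\<in>P. X \<subseteq> p" for X :: "'n set"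
  proof (cases "X = {}")
    case True
    then show ?thesis using partR by (auto simp: partition_on_def)
  next
    case False
    from X obtain c where c: "\<And>P. P \<in> ?M \<Longrightarrow> c P \<in> P \<and> X \<subseteq> c P" by metis
    have "restrict c ?M \<in> (\<Pi>\<^sub>E P\<in>?M. P)" using c by auto
    moreover have "X \<subseteq> \<Inter> (restrict c ?M ` ?M)" using c by auto
    ultimately have "\<Inter> (restrict c ?M ` ?M) \<in> ?R"
      using False unfolding common_refinement_def by blast
    with \<open>X \<subseteq> \<Inter> (restrict c ?M ` ?M)\<close> show ?thesis by blast
  qed
  have "merges_heads G F Or ?R"
    unfolding merges_heads_def[of G F Or ?R]
  proof (intro conjI ballI)
    show "refines UNIV (hcomponents F) ?R"
      unfolding refines_def
    proof (intro conjI ballI)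
      fix X assume "X \<in> hcomponents F"
      then show "\<exists>Y\<in>?R. X \<subseteq> Y"
        by (intro in_part) (auto simp: merges_heads_def refines_def)
    qed (rule partition_on_hcomponents partR)+
  next
    fix U assume "U \<in> G - F"
    have "\<exists>p\<in>?R. \<Union>(fst (Or U)) \<subseteq> p"
    proof (rule in_part)
      fix P assume "P \<in> ?M"
      with \<open>U \<in> G - F\<close> have "\<exists>p\<in>P. \<forall>\<beta>\<in>fst (Or U). \<beta> \<subseteq> p"
        unfolding merges_heads_def mem_Collect_eq by blast
      then show "\<exists>p\<in>P. \<Union>(fst (Or U)) \<subseteq> p" by (simp add: Sup_le_iff)
    qed
    then show "\<exists>p\<in>?R. \<forall>\<beta>\<in>fst (Or U). \<beta> \<subseteq> p" by (simp only: Sup_le_iff)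
  qed
  moreover have "refines UNIV ?R Q" if "merges_heads G F Or Q" for Q
    by (rule refines_common_refinement) (use part that in auto)
  ultimately show "\<exists>P. merges_heads G F Or P \<and> (\<forall>Q. merges_heads G F Or Q \<longrightarrow> refines UNIV P Q)"
    by blast
next
  fix P Q
  assume "merges_heads G F Or P \<and> (\<forall>Q. merges_heads G F Or Q \<longrightarrow> refines UNIV P Q)"
    and "merges_heads G F Or Q \<and> (\<forall>P. merges_heads G F Or P \<longrightarrow> refines UNIV Q P)"
  then have "refines UNIV P Q" "refines UNIV Q P" by simp_all
  then show "P = Q" by (rule refines_asym)
qed

lemma part_containing_ex1:
  assumes P: "partition_on UNIV P" and X: "\<exists>p\<in>P. X \<subseteq> p" "X \<noteq> {}"
  shows "\<exists>!p. p \<in> P \<and> X \<subseteq> p"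
proof (rule ex_ex1I)
  show "\<exists>p. p \<in> P \<and> X \<subseteq> p" using X by blast
next
  fix p q assume "p \<in> P \<and> X \<subseteq> p" "q \<in> P \<and> X \<subseteq> q"
  then have "p \<in> P" "q \<in> P" "p \<inter> q \<noteq> {}" using X(2) by auto
  then show "p = q" using P unfolding partition_on_def disjoint_def by blast
qed

lemma parts_merges_heads: "merges_heads G F Or (parts G F Or)"
  unfolding parts_def by (rule conjunct1[OF theI'[OF parts_ex1]])

lemma parts_containing_ex1:
  assumes Or: "Or \<in> orientations G F" and U: "U \<in> G - F"
  shows "\<exists>!p. p \<in> parts G F Or \<and> \<Union>(fst (Or U)) \<subseteq> p"
    and "\<beta> \<in> snd (Or U) \<Longrightarrow> \<exists>!p. p \<in> parts G F Or \<and> \<beta> \<subseteq> p"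
proof -
  have m: "refines UNIV (hcomponents F) (parts G F Or)"
    "\<exists>p\<in>parts G F Or. \<forall>\<beta>\<in>fst (Or U). \<beta> \<subseteq> p"
    using parts_merges_heads[of G F Or] U by (auto simp: merges_heads_def)
  then have P: "partition_on UNIV (parts G F Or)" by (simp add: refines_def)
  have "Or U \<in> {(a, b). a \<noteq> {} \<and> b \<noteq> {} \<and> a \<inter> b = {} \<and> a \<union> b = contract_edge F U}"
    using Or U unfolding orientations_def by (rule PiE_mem)
  then have "fst (Or U) \<noteq> {}" "fst (Or U) \<union> snd (Or U) = contract_edge F U"
    by (simp_all add: case_prod_beta)
  moreover have "contract_edge F U \<subseteq> hcomponents F"
    unfolding contract_edge_def by blast
  ultimately have sub: "fst (Or U) \<noteq> {}" "fst (Or U) \<subseteq> hcomponents F"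
    "snd (Or U) \<subseteq> hcomponents F" by blast+
  have ne: "{} \<notin> hcomponents F"
    using partition_on_hcomponents by (auto simp: partition_on_def)
  show "\<exists>!p. p \<in> parts G F Or \<and> \<Union>(fst (Or U)) \<subseteq> p"
  proof (rule part_containing_ex1[OF P])
    show "\<exists>p\<in>parts G F Or. \<Union>(fst (Or U)) \<subseteq> p" using m(2) by (simp add: Sup_le_iff)
    obtain \<beta> where "\<beta> \<in> fst (Or U)" "\<beta> \<in> hcomponents F" using sub(1,2) by blast
    moreover from this have "\<beta> \<noteq> {}" using ne by metis
    ultimately show "\<Union>(fst (Or U)) \<noteq> {}" by blast
  qed
  show "\<exists>!p. p \<in> parts G F Or \<and> \<beta> \<subseteq> p" if "\<beta> \<in> snd (Or U)"
  proof (rule part_containing_ex1[OF P])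
    have "\<beta> \<in> hcomponents F" using sub(3) that by blast
    then show "\<exists>p\<in>parts G F Or. \<beta> \<subseteq> p" "\<beta> \<noteq> {}"
      using m(1) ne unfolding refines_def by blast+
  qed
qed

end

theory Submission
  imports Defs
begin

text \<open>
  A linear functional \<open>x\<close> with values $x_i = \mathbf x(e_i)$ cuts out the face of $P_G$ that is
  determined by the sets $\mathrm{argmax}_U\, x$, $U \in G$, and \<open>y\<close> lies in the normal cone of
  that face iff $\mathrm{argmax}_U\, x \subseteq \mathrm{argmax}_U\, y$ for all \<open>U\<close>. These argmax
  data are the same thing as a pair $(F, \mathcal O)$: \<open>F\<close> consists of the \<open>U\<close> on which \<open>x\<close> is
  constant, and $\mathfrak a_U$ of the blocks on which \<open>x\<close> attains its maximum over \<open>U\<close>.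
  Such an $\mathcal O$ is acyclic because \<open>x\<close> strictly decreases along arrows; conversely, for an
  acyclic $\mathcal O$ a height function on $(G/F)/\mathcal O$ gives an \<open>x\<close> that induces it.
  The inequalities defining $C_{\mathcal O}$ say exactly that the argmax sets of \<open>x\<close> are contained
  in those of \<open>y\<close>.
\<close>

section \<open>Maximizer sets and the faces of a polytope\<close>

text \<open>The carrier type is left open for two uses: \<open>S\<close> a hyperedge with
  \<open>h\<close> the coordinates of a functional, and \<open>S\<close> a polytope with
  \<open>h\<close> the functional itself.\<close>

definition maximizers :: "('a \<Rightarrow> real) \<Rightarrow> 'a set \<Rightarrow> 'a set" where
  "maximizers h S = {v \<in> S. \<forall>w\<in>S. h w \<le> h v}"

lemma maximizers_subset: "maximizers h S \<subseteq> S"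
  by (auto simp: maximizers_def)

lemma maximizers_nonempty:
  assumes "finite S" "S \<noteq> {}"
  shows "maximizers h S \<noteq> {}"
proof -
  have "Max (h ` S) \<in> h ` S" using assms by (intro Max_in) auto
  then obtain v where "v \<in> S" "h v = Max (h ` S)" by auto
  then have "v \<in> maximizers h S" using assms(1) by (simp add: maximizers_def)
  then show ?thesis by blast
qed

lemma maximizers_eq_self_iff: "maximizers h S = S \<longleftrightarrow> (\<forall>i\<in>S. \<forall>j\<in>S. h i = h j)"
proof
  assume "maximizers h S = S"
  then have "h j \<le> h i" if "i \<in> S" "j \<in> S" for i j using that by (auto simp: maximizers_def)
  then show "\<forall>i\<in>S. \<forall>j\<in>S. h i = h j" by (simp add: order.antisym)
next
  assume "\<forall>i\<in>S. \<forall>j\<in>S. h i = h j"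
  then have "h w \<le> h v" if "v \<in> S" "w \<in> S" for v w using that by (intro eq_refl) blast
  then show "maximizers h S = S" by (auto simp: maximizers_def)
qed

lemma linear_functional_inner:
  fixes x :: "'a::euclidean_space \<Rightarrow> real"
  assumes "linear x"
  obtains a where "\<forall>v. x v = a \<bullet> v"
proof
  show "\<forall>v. x v = adjoint x 1 \<bullet> v"
    using adjoint_works[OF assms, of _ 1] by (simp add: inner_commute)
qed

lemma linear_of_axis_values:
  obtains x :: "real ^ 'n \<Rightarrow> real" where "linear x" "\<forall>i. x (axis i 1) = h i"
proof
  show "linear (\<lambda>v::real ^ 'n. vec_lambda h \<bullet> v)"
    by (rule bounded_linear.linear[OF bounded_linear_inner_right])
  show "\<forall>i. vec_lambda h \<bullet> axis i 1 = h i"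
    by (simp add: inner_axis)
qed

lemma maximizers_face_of:
  fixes P :: "'a::euclidean_space set"
  assumes "convex P" "linear x"
  shows "maximizers x P face_of P"
proof (cases "maximizers x P = {}")
  case False
  then obtain u where u: "u \<in> P" "\<forall>w\<in>P. x w \<le> x u" by (auto simp: maximizers_def)
  obtain a where a: "\<forall>v. x v = a \<bullet> v"
    by (rule linear_functional_inner[OF assms(2)])
  have "maximizers x P = P \<inter> {v. a \<bullet> v = x u}"
    using u by (force simp: maximizers_def a[rule_format, symmetric])
  then show ?thesis
    using face_of_Int_supporting_hyperplane_le[OF assms(1), of a "x u"] u(2)
    by (simp add: a[rule_format, symmetric])
qed simp

text \<open>Every face of a polytope is exposed, so a nonempty face is the maximizer set of the
  functional exposing it. Conversely, compactness makes a linear functional attain its maximum, so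
  its maximizer set is a nonempty face.\<close>

lemma nonempty_faces_polytope:
  fixes P :: "'a::euclidean_space set"
  assumes P: "polytope P" "P \<noteq> {}"
  shows "nonempty_faces P = {maximizers x P | x. linear x}"
proof (intro equalityI subsetI)
  fix f assume "f \<in> nonempty_faces P"
  then have f: "f exposed_face_of P" "f \<noteq> {}"
    using exposed_face_of_polyhedron[OF polytope_imp_polyhedron[OF P(1)]]
    by (auto simp: nonempty_faces_def)
  then obtain a b where ab: "P \<subseteq> {v. a \<bullet> v \<le> b}" "f = P \<inter> {v. a \<bullet> v = b}"
    unfolding exposed_face_of_def by blast
  have "f = maximizers (\<lambda>v. a \<bullet> v) P"
    using ab f(2) by (force simp: maximizers_def)
  moreover have "linear (\<lambda>v. a \<bullet> v)"
    by (rule bounded_linear.linear[OF bounded_linear_inner_right])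
  ultimately show "f \<in> {maximizers x P | x. linear x}" by blast
next
  fix f assume "f \<in> {maximizers x P | x. linear x}"
  then obtain x where x: "linear x" "f = maximizers x P" by blast
  have "f face_of P"
    using maximizers_face_of[OF polytope_imp_convex[OF P(1)] x(1)] x(2) by simp
  moreover have "continuous_on P x"
    using x(1) by (simp add: linear_continuous_on linear_linear)
  then have "f \<noteq> {}"
    using continuous_attains_sup[OF polytope_imp_compact[OF P(1)] P(2)] x(2)
    by (auto simp: maximizers_def)
  ultimately show "f \<in> nonempty_faces P" by (simp add: nonempty_faces_def)
qed

lemma mem_normal_cone_maximizers:
  assumes "maximizers x P \<noteq> {}"
  shows "y \<in> normal_cone P (maximizers x P) \<longleftrightarrow> linear y \<and> maximizers x P \<subseteq> maximizers y P"
  by (auto simp: normal_cone_def maximizers_def)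

section \<open>Minkowski sums of simplices\<close>

text \<open>The value of a linear functional on a sum is the sum of its values on the summands, and
  these vary independently; exchanging the single summand at \<open>i\<close> isolates its
  contribution.\<close>

lemma mem_maximizers_sum_iff:
  fixes x :: "'a::real_vector \<Rightarrow> real"
  assumes I: "finite I" and x: "linear x" and s: "\<forall>i\<in>I. s i \<in> S i"
  shows "sum s I \<in> maximizers x (sum S I) \<longleftrightarrow> (\<forall>i\<in>I. s i \<in> maximizers x (S i))"
proof (intro iffI ballI)
  assume max: "\<forall>i\<in>I. s i \<in> maximizers x (S i)"
  have "x (sum t I) \<le> x (sum s I)" if "\<forall>i\<in>I. t i \<in> S i" for t
    using max that unfolding linear_sum[OF x] by (intro sum_mono) (auto simp: maximizers_def)
  then show "sum s I \<in> maximizers x (sum S I)"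
    using s unfolding maximizers_def set_sum_alt[OF I] by blast
next
  fix i assume max: "sum s I \<in> maximizers x (sum S I)" and i: "i \<in> I"
  have "x w \<le> x (s i)" if w: "w \<in> S i" for w
  proof -
    have "sum (s(i := w)) I \<in> sum S I"
    proof -
      have "\<forall>j\<in>I. (s(i := w)) j \<in> S j" using s w by simp
      then show ?thesis unfolding set_sum_alt[OF I] by blast
    qed
    then have "x (sum (s(i := w)) I) \<le> x (sum s I)"
      using max by (simp add: maximizers_def)
    moreover have "sum (s(i := w)) (I - {i}) = sum s (I - {i})" by (intro sum.cong) auto
    ultimately show ?thesis
      by (simp add: sum.remove[OF I i] linear_add[OF x])
  qed
  then show "s i \<in> maximizers x (S i)" using s i by (simp add: maximizers_def)
qed

text \<open>Vertices suffice to test maximality: the half-space of points whose value is at most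
  that of \<open>axis i 1\<close> is convex, so it contains the simplex once it contains the
  vertices.\<close>

lemma axis_mem_maximizers_simplex_iff:
  fixes x :: "real ^ 'n::finite \<Rightarrow> real"
  assumes x: "linear x" and i: "i \<in> U"
  shows "axis i 1 \<in> maximizers x (simplex_of U) \<longleftrightarrow> i \<in> maximizers (\<lambda>i. x (axis i 1)) U"
proof
  assume "axis i 1 \<in> maximizers x (simplex_of U)"
  moreover have "axis j 1 \<in> simplex_of U" if "j \<in> U" for j
    using that unfolding simplex_of_def by (intro hull_inc) simp
  ultimately show "i \<in> maximizers (\<lambda>i. x (axis i 1)) U"
    using i by (simp add: maximizers_def)
next
  assume max: "i \<in> maximizers (\<lambda>i. x (axis i 1)) U"
  obtain a where "\<forall>v. x v = a \<bullet> v"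
    by (rule linear_functional_inner[OF x])
  then have "convex {v. x v \<le> x (axis i 1)}"
    by (simp add: convex_halfspace_le)
  then have "simplex_of U \<subseteq> {v. x v \<le> x (axis i 1)}"
    unfolding simplex_of_def using max by (intro hull_minimal) (auto simp: maximizers_def)
  then show "axis i 1 \<in> maximizers x (simplex_of U)"
    using i unfolding maximizers_def simplex_of_def by (auto intro!: hull_inc)
qed

text \<open>The maximizers of \<open>x\<close> form a face, which is the hull of some vertices of
  the simplex. These vertices maximize \<open>y\<close> as well, and the maximizers of
  \<open>y\<close> form a convex set, so the whole face follows.\<close>

lemma maximizers_simplex_subset_iff:
  fixes x y :: "real ^ 'n::finite \<Rightarrow> real"
  assumes x: "linear x" and y: "linear y"
    and sub: "maximizers (\<lambda>i. x (axis i 1)) U \<subseteq> maximizers (\<lambda>i. y (axis i 1)) U"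
  shows "maximizers x (simplex_of U) \<subseteq> maximizers y (simplex_of U)"
proof -
  let ?T = "maximizers x (simplex_of U)"
  have cvx: "convex (simplex_of U)" by (simp add: simplex_of_def)
  have "?T face_of convex hull ((\<lambda>i. axis i 1) ` U)"
    using maximizers_face_of[OF cvx x] by (simp add: simplex_of_def)
  then obtain V where V: "V \<subseteq> (\<lambda>i. axis i 1) ` U" "?T = convex hull V"
    by (rule face_of_convex_hull_subset[OF finite_imp_compact[OF finite_imageI[OF finite]]])
  have "V \<subseteq> maximizers y (simplex_of U)"
  proof
    fix v assume v: "v \<in> V"
    then obtain i where i: "i \<in> U" "v = axis i 1" using V(1) by blast
    have "v \<in> ?T" unfolding V(2) using v by (rule hull_inc)
    then show "v \<in> maximizers y (simplex_of U)"
      using i sub axis_mem_maximizers_simplex_iff[OF x i(1)]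
        axis_mem_maximizers_simplex_iff[OF y i(1)] by blast
  qed
  moreover have "convex (maximizers y (simplex_of U))"
    by (rule face_of_imp_convex[OF maximizers_face_of[OF cvx y]])
  ultimately show ?thesis unfolding V(2) by (rule hull_minimal)
qed

lemma polytope_hypergraphic:
  fixes G :: "'n::finite set set"
  assumes "hypergraph G"
  shows "polytope (hypergraphic_polytope G)" "hypergraphic_polytope G \<noteq> {}"
proof -
  have "hypergraphic_polytope G = convex hull (\<Sum>U\<in>G. (\<lambda>i. axis i 1) ` U)"
    by (simp add: hypergraphic_polytope_def simplex_of_def convex_hull_set_sum)
  moreover have "finite (\<Sum>U\<in>G. (\<lambda>i. axis i 1 :: real ^ 'n) ` U)"
    by (rule finite_set_sum) simp_all
  ultimately show "polytope (hypergraphic_polytope G)" unfolding polytope_def by blast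
  have "simplex_of U \<noteq> {}" if "U \<in> G" for U
    using that assms by (auto simp: hypergraph_def simplex_of_def)
  then have "\<forall>U\<in>G. (SOME v. v \<in> simplex_of U) \<in> simplex_of U"
    by (simp add: some_in_eq)
  then have "(\<Sum>U\<in>G. SOME v. v \<in> simplex_of U) \<in> hypergraphic_polytope G"
    unfolding hypergraphic_polytope_def set_sum_alt[OF finite] by blast
  then show "hypergraphic_polytope G \<noteq> {}" by blast
qed

text \<open>Reduces inclusion of faces to inclusion of argmax sets. From right to left, a maximal
  point is split into summands and the simplex case applies to each; from left to right, sums of
  simplex vertices serve as test points.\<close>

lemma maximizers_hypergraphic_subset_iff:
  fixes G :: "'n::finite set set"
  assumes G: "hypergraph G" and x: "linear x" and y: "linear y"
  shows "maximizers x (hypergraphic_polytope G) \<subseteq> maximizers y (hypergraphic_polytope G) \<longleftrightarrow>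
    (\<forall>U\<in>G. maximizers (\<lambda>i. x (axis i 1)) U \<subseteq> maximizers (\<lambda>i. y (axis i 1)) U)"
    (is "?L \<longleftrightarrow> ?R")
proof
  assume R: ?R
  show ?L
  proof
    fix v assume v: "v \<in> maximizers x (hypergraphic_polytope G)"
    then obtain s where s: "v = sum s G" "\<forall>U\<in>G. s U \<in> simplex_of U"
      unfolding maximizers_def hypergraphic_polytope_def set_sum_alt[OF finite] by blast
    from v have "\<forall>U\<in>G. s U \<in> maximizers x (simplex_of U)"
      using mem_maximizers_sum_iff[OF finite x s(2)] s(1)
      by (simp add: hypergraphic_polytope_def)
    then have "\<forall>U\<in>G. s U \<in> maximizers y (simplex_of U)"
      using R maximizers_simplex_subset_iff[OF x y] by blast
    then show "v \<in> maximizers y (hypergraphic_polytope G)"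
      using mem_maximizers_sum_iff[OF finite y s(2)] s(1)
      by (simp add: hypergraphic_polytope_def)
  qed
next
  assume L: ?L
  show ?R
  proof (intro ballI subsetI)
    fix U i assume U: "U \<in> G" and i: "i \<in> maximizers (\<lambda>i. x (axis i 1)) U"
    have "\<exists>j. j \<in> maximizers (\<lambda>i. x (axis i 1)) V" if "V \<in> G" for V
      using maximizers_nonempty[of V] that G by (fastforce simp: hypergraph_def)
    then obtain c where c: "\<And>V. V \<in> G \<Longrightarrow> c V \<in> maximizers (\<lambda>i. x (axis i 1)) V" by metis
    \<comment> \<open>A maximizer is picked in every hyperedge, the one in \<open>U\<close> being
      the given \<open>i\<close>. The sum of these vertices is maximal for \<open>x\<close>, hence
      for \<open>y\<close>, and its summand at \<open>U\<close> is \<open>axis i 1\<close>.\<close>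
    let ?c = "c(U := i)"
    have cm: "?c V \<in> maximizers (\<lambda>i. x (axis i 1)) V" if "V \<in> G" for V
      using c i that by simp
    then have cV: "?c V \<in> V" if "V \<in> G" for V
      using that unfolding maximizers_def by blast
    let ?s = "\<lambda>V. axis (?c V) 1"
    have s: "\<forall>V\<in>G. ?s V \<in> simplex_of V"
      using cV unfolding simplex_of_def by (intro ballI hull_inc) blast
    have "\<forall>V\<in>G. ?s V \<in> maximizers x (simplex_of V)"
      using cV cm axis_mem_maximizers_simplex_iff[OF x] by blast
    then have "sum ?s G \<in> maximizers x (hypergraphic_polytope G)"
      using mem_maximizers_sum_iff[OF finite x s] by (simp add: hypergraphic_polytope_def)
    then have "sum ?s G \<in> maximizers y (hypergraphic_polytope G)" using L by blast
    then have "\<forall>V\<in>G. ?s V \<in> maximizers y (simplex_of V)"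
      using mem_maximizers_sum_iff[OF finite y s] by (simp add: hypergraphic_polytope_def)
    then have "axis i 1 \<in> maximizers y (simplex_of U)" using U by auto
    moreover have "i \<in> U" using i by (simp add: maximizers_def)
    ultimately show "i \<in> maximizers (\<lambda>i. y (axis i 1)) U"
      using axis_mem_maximizers_simplex_iff[OF y] by blast
  qed
qed

section \<open>Components, parts and level sets\<close>

lemma hyperedge_subset_hcomponent:
  assumes "U \<in> F" "U \<noteq> {}"
  obtains C where "C \<in> hcomponents F" "U \<subseteq> C"
proof -
  let ?R = "{(a, b). \<exists>U\<in>F. a \<in> U \<and> b \<in> U}"
  obtain i where i: "i \<in> U" using assms(2) by blast
  have "?R\<^sup>* `` {i} \<in> hcomponents F"
    unfolding hcomponents_def by (rule quotientI) simp
  moreover have "U \<subseteq> ?R\<^sup>* `` {i}"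
  proof
    fix j assume "j \<in> U"
    then have "(i, j) \<in> ?R" using assms(1) i by blast
    then show "j \<in> ?R\<^sup>* `` {i}" by blast
  qed
  ultimately show thesis by (rule that)
qed

lemma const_on_hcomponent:
  assumes h: "\<And>U i j. U \<in> F \<Longrightarrow> i \<in> U \<Longrightarrow> j \<in> U \<Longrightarrow> h i = h j"
    and C: "C \<in> hcomponents F" "a \<in> C" "b \<in> C"
  shows "h a = h b"
proof -
  let ?R = "{(a, b). \<exists>U\<in>F. a \<in> U \<and> b \<in> U}"
  have step: "h i = h j" if "(i, j) \<in> ?R\<^sup>*" for i j
    using that
  proof (induction rule: rtrancl_induct)
    case (step k l)
    then obtain U where "U \<in> F" "k \<in> U" "l \<in> U" by blast
    then have "h k = h l" by (rule h)
    with step.IH show ?case by simp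
  qed simp
  from C(1) obtain i where "C = ?R\<^sup>* `` {i}"
    unfolding hcomponents_def by (blast elim: quotientE)
  then have "h i = h a" "h i = h b" using C(2,3) by (auto intro: step)
  then show ?thesis by simp
qed

lemma partition_on_fibers: "partition_on UNIV (range (\<lambda>i. {j. h j = h i}))"
  by (auto simp: partition_on_def disjoint_def)

lemma partition_on_parts: "partition_on UNIV (parts G F Or)"
  using parts_merges_heads by (auto simp: merges_heads_def refines_def)

lemma hcomponent_subset_part:
  assumes "C \<in> hcomponents F"
  obtains p where "p \<in> parts G F Or" "C \<subseteq> p"
  using parts_merges_heads[of G F Or] assms by (auto simp: merges_heads_def refines_def)

text \<open>The level sets of such an \<open>h\<close> form a partition that is coarser than the
  components and has every head inside one class. By minimality \<open>parts G F Or\<close> refines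
  it.\<close>

lemma const_on_parts:
  assumes C: "\<And>C i j. C \<in> hcomponents F \<Longrightarrow> i \<in> C \<Longrightarrow> j \<in> C \<Longrightarrow> h i = h j"
    and heads: "\<And>U i j. U \<in> G - F \<Longrightarrow> i \<in> \<Union>(fst (Or U)) \<Longrightarrow> j \<in> \<Union>(fst (Or U)) \<Longrightarrow> h i = h j"
    and p: "p \<in> parts G F Or" "a \<in> p" "b \<in> p"
  shows "h a = h b"
proof -
  let ?Q = "range (\<lambda>i. {j. h j = h i})"
  have fiber: "\<exists>q\<in>?Q. X \<subseteq> q" if X: "\<And>i j. i \<in> X \<Longrightarrow> j \<in> X \<Longrightarrow> h i = h j" for X
  proof (cases "X = {}")
    case False
    then obtain i where "i \<in> X" by blast
    then have "X \<subseteq> {j. h j = h i}" using X by blast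
    then show ?thesis by blast
  qed simp
  have "merges_heads G F Or ?Q"
    unfolding merges_heads_def refines_def
  proof (intro conjI ballI)
    fix U assume "U \<in> G - F"
    then have "\<exists>q\<in>?Q. \<Union>(fst (Or U)) \<subseteq> q" by (intro fiber heads)
    then show "\<exists>q\<in>?Q. \<forall>\<beta>\<in>fst (Or U). \<beta> \<subseteq> q" by (simp only: Sup_le_iff)
  next
    fix X assume "X \<in> hcomponents F"
    then show "\<exists>q\<in>?Q. X \<subseteq> q" by (intro fiber C)
  qed (rule partition_on_hcomponents partition_on_fibers)+
  then have "refines UNIV (parts G F Or) ?Q"
    using theI'[OF parts_ex1[of G F Or]] unfolding parts_def by blast
  then obtain i where "p \<subseteq> {j. h j = h i}" using p(1) unfolding refines_def by blast
  then have "h a = h i" "h b = h i" using p(2,3) by blast+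
  then show ?thesis by simp
qed

section \<open>Orientations and their arrows\<close>

lemma orientationsD:
  assumes "Or \<in> orientations G F" "U \<in> G - F"
  shows "fst (Or U) \<noteq> {}" "snd (Or U) \<noteq> {}" "fst (Or U) \<inter> snd (Or U) = {}"
    "fst (Or U) \<union> snd (Or U) = contract_edge F U"
  using PiE_mem[OF assms[unfolded orientations_def]] by (simp_all add: case_prod_beta)

lemma contract_edge_cover: "U \<subseteq> \<Union>(contract_edge F U)"
proof
  fix i assume "i \<in> U"
  moreover have "i \<in> \<Union>(hcomponents F)"
    using partition_on_hcomponents[of F] by (simp add: partition_on_def)
  ultimately show "i \<in> \<Union>(contract_edge F U)" by (auto simp: contract_edge_def)
qed

lemma hcomponents_disjoint:
  assumes "\<beta> \<in> hcomponents F" "\<gamma> \<in> hcomponents F" "i \<in> \<beta>" "i \<in> \<gamma>"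
  shows "\<beta> = \<gamma>"
  using partition_onD2[OF partition_on_hcomponents[of F]] assms by (auto simp: disjoint_def)

text \<open>A head is determined by the vertices of \<open>U\<close> that it covers: its blocks all
  meet \<open>U\<close>, and by disjointness no other block contains a vertex of \<open>M\<close>.
  With \<open>M\<close> an argmax set, this recovers the orientation from a function.\<close>

lemma head_eq_blocks_meeting:
  assumes Or: "Or \<in> orientations G F" and U: "U \<in> G - F"
    and M: "M = U \<inter> \<Union>(fst (Or U))"
  shows "fst (Or U) = {\<beta> \<in> contract_edge F U. \<beta> \<inter> M \<noteq> {}}"
proof (intro equalityI subsetI)
  fix \<beta> assume "\<beta> \<in> fst (Or U)"
  then show "\<beta> \<in> {\<beta> \<in> contract_edge F U. \<beta> \<inter> M \<noteq> {}}"
    using orientationsD(4)[OF Or U] M by (auto simp: contract_edge_def)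
next
  fix \<beta> assume \<beta>: "\<beta> \<in> {\<beta> \<in> contract_edge F U. \<beta> \<inter> M \<noteq> {}}"
  then obtain i \<gamma> where "i \<in> \<beta>" "i \<in> \<gamma>" "\<gamma> \<in> fst (Or U)" using M by blast
  moreover from this have "\<beta> = \<gamma>"
    using \<beta> orientationsD(4)[OF Or U]
    by (intro hcomponents_disjoint[of \<beta> F \<gamma> i]) (auto simp: contract_edge_def)
  ultimately show "\<beta> \<in> fst (Or U)" by simp
qed

lemma tail_orientation_digraph:
  assumes "Or \<in> orientations G F" "U \<in> G - F"
  shows "tail (orientation_digraph G F Or) (U, \<beta>) \<in> parts G F Or"
    "\<Union>(fst (Or U)) \<subseteq> tail (orientation_digraph G F Or) (U, \<beta>)"
  using theI'[OF parts_containing_ex1(1)[OF assms]] by (simp_all add: orientation_digraph_def)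

lemma head_orientation_digraph:
  assumes "Or \<in> orientations G F" "U \<in> G - F" "\<beta> \<in> snd (Or U)"
  shows "head (orientation_digraph G F Or) (U, \<beta>) \<in> parts G F Or"
    "\<beta> \<subseteq> head (orientation_digraph G F Or) (U, \<beta>)"
  using theI'[OF parts_containing_ex1(2)[OF assms]] by (simp_all add: orientation_digraph_def)

lemma arcs_orientation_digraph:
  "(U, \<beta>) \<in> arcs (orientation_digraph G F Or) \<longleftrightarrow> U \<in> G - F \<and> \<beta> \<in> snd (Or U)"
  by (simp add: orientation_digraph_def)

lemma wf_orientation_digraph:
  assumes "Or \<in> orientations G F"
  shows "wf_digraph (orientation_digraph G F Or)"
proof
  fix e assume e: "e \<in> arcs (orientation_digraph G F Or)"
  obtain U \<beta> where [simp]: "e = (U, \<beta>)" by fastforce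
  have *: "U \<in> G - F" "\<beta> \<in> snd (Or U)" using e by (simp_all add: arcs_orientation_digraph)
  have "verts (orientation_digraph G F Or) = parts G F Or" by (simp add: orientation_digraph_def)
  then show "tail (orientation_digraph G F Or) e \<in> verts (orientation_digraph G F Or)"
    "head (orientation_digraph G F Or) e \<in> verts (orientation_digraph G F Or)"
    using tail_orientation_digraph(1)[OF assms *(1)] head_orientation_digraph(1)[OF assms *]
    by simp_all
qed

section \<open>Functions inducing an orientation\<close>

text \<open>
  \<open>realizes\<close> describes the relative interior of $C_{\mathcal O}$, \<open>weakly_realizes\<close> the whole
  cone.
\<close>

definition weakly_realizes ::
    "'n set set \<Rightarrow> 'n set set \<Rightarrow> 'n orientation \<Rightarrow> ('n \<Rightarrow> real) \<Rightarrow> bool" where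
  "weakly_realizes G F Or h \<longleftrightarrow>
    (\<forall>U\<in>F. U \<subseteq> maximizers h U) \<and> (\<forall>U\<in>G - F. U \<inter> \<Union>(fst (Or U)) \<subseteq> maximizers h U)"

definition realizes ::
    "'n set set \<Rightarrow> 'n set set \<Rightarrow> 'n orientation \<Rightarrow> ('n \<Rightarrow> real) \<Rightarrow> bool" where
  "realizes G F Or h \<longleftrightarrow>
    (\<forall>U\<in>F. maximizers h U = U) \<and> (\<forall>U\<in>G - F. maximizers h U = U \<inter> \<Union>(fst (Or U)))"

lemma realizes_imp_weakly_realizes: "realizes G F Or h \<Longrightarrow> weakly_realizes G F Or h"
  by (auto simp: realizes_def weakly_realizes_def)

text \<open>By \<open>const_on_parts\<close> only components and heads matter. Values agree along
  each hyperedge of \<open>F\<close>, hence on components; every block of a head meets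
  \<open>U\<close>, only in maximizers of \<open>h\<close>, and all maximizers have the same
  value.\<close>

lemma weakly_realizes_const_on_parts:
  assumes Or: "Or \<in> orientations G F" and h: "weakly_realizes G F Or h"
  shows "\<forall>p\<in>parts G F Or. \<forall>a\<in>p. \<forall>b\<in>p. h a = h b"
proof -
  have edge: "h i = h j" if "U \<in> F" "i \<in> U" "j \<in> U" for U i j
    using h that by (intro antisym) (auto simp: weakly_realizes_def maximizers_def)
  have C: "h i = h j" if "C \<in> hcomponents F" "i \<in> C" "j \<in> C" for C i j
    by (rule const_on_hcomponent[OF edge that])
  have meet: "\<exists>k \<in> U \<inter> \<Union>(fst (Or U)). h l = h k"
    if U: "U \<in> G - F" and l: "l \<in> \<Union>(fst (Or U))" for U l
  proof -
    obtain \<beta> where \<beta>: "\<beta> \<in> fst (Or U)" "l \<in> \<beta>" using l by blast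
    then have "\<beta> \<in> hcomponents F" "\<beta> \<inter> U \<noteq> {}"
      using orientationsD(4)[OF Or U] by (auto simp: contract_edge_def)
    then show ?thesis using \<beta> C by blast
  qed
  have "h i = h j" if U: "U \<in> G - F" and i: "i \<in> \<Union>(fst (Or U))" and j: "j \<in> \<Union>(fst (Or U))"
    for U i j
  proof -
    obtain k l where kl: "k \<in> U \<inter> \<Union>(fst (Or U))" "h i = h k"
        "l \<in> U \<inter> \<Union>(fst (Or U))" "h j = h l"
      using meet[OF U i] meet[OF U j] by blast
    have "U \<inter> \<Union>(fst (Or U)) \<subseteq> maximizers h U" using h U by (simp add: weakly_realizes_def)
    then have "k \<in> maximizers h U" "l \<in> maximizers h U" using kl by blast+
    then have "h k = h l" by (intro antisym) (auto simp: maximizers_def)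
    with kl show ?thesis by simp
  qed
  with C show ?thesis by (intro ballI) (rule const_on_parts)
qed

text \<open>Both end parts of an arrow contain vertices of \<open>U\<close>, one covered by the head
  and one not. As \<open>h\<close> is constant on parts, comparing parts along the arrow becomes
  comparing two vertices of one hyperedge.\<close>

lemma arrow_values:
  assumes Or: "Or \<in> orientations G F" and U: "U \<in> G - F" and \<beta>: "\<beta> \<in> snd (Or U)"
    and h: "\<forall>p\<in>parts G F Or. \<forall>a\<in>p. \<forall>b\<in>p. h a = h b"
  obtains i j where "i \<in> U \<inter> \<Union>(fst (Or U))" "j \<in> U - \<Union>(fst (Or U))"
    "\<forall>a\<in>tail (orientation_digraph G F Or) (U, \<beta>). h a = h i"
    "\<forall>b\<in>head (orientation_digraph G F Or) (U, \<beta>). h b = h j"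
proof -
  have blocks: "\<gamma> \<in> hcomponents F" "\<gamma> \<inter> U \<noteq> {}" if "\<gamma> \<in> fst (Or U) \<union> snd (Or U)" for \<gamma>
    using that unfolding orientationsD(4)[OF Or U] by (auto simp: contract_edge_def)
  obtain i where i: "i \<in> U \<inter> \<Union>(fst (Or U))"
    using orientationsD(1)[OF Or U] blocks(2) by blast
  obtain j where j: "j \<in> \<beta>" "j \<in> U" using blocks(2)[of \<beta>] \<beta> by blast
  have "j \<notin> \<gamma>" if "\<gamma> \<in> fst (Or U)" for \<gamma>
    using that hcomponents_disjoint[of \<beta> F \<gamma> j] blocks(1) \<beta> j(1) orientationsD(3)[OF Or U]
    by blast
  then have "j \<in> U - \<Union>(fst (Or U))" using j by blast
  moreover have "i \<in> tail (orientation_digraph G F Or) (U, \<beta>)"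
    using tail_orientation_digraph(2)[OF Or U] i by blast
  then have "\<forall>a\<in>tail (orientation_digraph G F Or) (U, \<beta>). h a = h i"
    using h tail_orientation_digraph(1)[OF Or U] by blast
  moreover have "j \<in> head (orientation_digraph G F Or) (U, \<beta>)"
    using head_orientation_digraph(2)[OF Or U \<beta>] j by blast
  then have "\<forall>b\<in>head (orientation_digraph G F Or) (U, \<beta>). h b = h j"
    using h head_orientation_digraph(1)[OF Or U \<beta>] by blast
  ultimately show thesis using that[of i j] i by blast
qed

lemma const_on_parts_imp:
  assumes F: "\<forall>U\<in>F. U \<noteq> {}" and Or: "Or \<in> orientations G F"
    and h: "\<forall>p\<in>parts G F Or. \<forall>a\<in>p. \<forall>b\<in>p. h a = h b"
  shows "U \<in> F \<Longrightarrow> i \<in> U \<Longrightarrow> j \<in> U \<Longrightarrow> h i = h j"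
    and "U \<in> G - F \<Longrightarrow> i \<in> \<Union>(fst (Or U)) \<Longrightarrow> j \<in> \<Union>(fst (Or U)) \<Longrightarrow> h i = h j"
proof -
  assume U: "U \<in> F" "i \<in> U" "j \<in> U"
  obtain C where "C \<in> hcomponents F" "U \<subseteq> C"
    using hyperedge_subset_hcomponent U F by blast
  moreover from this obtain p where "p \<in> parts G F Or" "C \<subseteq> p"
    using hcomponent_subset_part by blast
  ultimately show "h i = h j" using U h by blast
next
  assume "U \<in> G - F" "i \<in> \<Union>(fst (Or U))" "j \<in> \<Union>(fst (Or U))"
  \<comment> \<open>The source part of an arrow depends on \<open>U\<close> alone, so any second
    component serves.\<close>
  then show "h i = h j"
    using tail_orientation_digraph[OF Or, of U undefined] h by blast
qed

lemma tail_block_arrow: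
  assumes "Or \<in> orientations G F" "U \<in> G - F" "j \<in> U - \<Union>(fst (Or U))"
  obtains \<beta> where "\<beta> \<in> snd (Or U)" "j \<in> head (orientation_digraph G F Or) (U, \<beta>)"
proof -
  obtain \<beta> where "\<beta> \<in> contract_edge F U" "j \<in> \<beta>"
    using contract_edge_cover[of U F] assms(3) by blast
  then have "\<beta> \<in> snd (Or U)" using assms(3) orientationsD(4)[OF assms(1,2)] by blast
  then show thesis
    using that \<open>j \<in> \<beta>\<close> head_orientation_digraph(2)[OF assms(1,2)] by blast
qed

text \<open>The right-hand side is the system defining the orientation cone. Forward,
  \<open>arrow_values\<close> turns an arrow into two vertices of \<open>U\<close>; backward, a
  vertex of \<open>U\<close> is either covered by the head, where values agree, or lies at the end
  of an arrow leaving it.\<close>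

lemma weakly_realizes_iff_arrows:
  assumes F: "\<forall>U\<in>F. U \<noteq> {}" and Or: "Or \<in> orientations G F"
  shows "weakly_realizes G F Or h \<longleftrightarrow>
    (\<forall>p\<in>parts G F Or. \<forall>a\<in>p. \<forall>b\<in>p. h a = h b) \<and>
    (\<forall>e\<in>arcs (orientation_digraph G F Or).
      \<forall>a\<in>tail (orientation_digraph G F Or) e. \<forall>b\<in>head (orientation_digraph G F Or) e. h a \<ge> h b)"
    (is "_ \<longleftrightarrow> ?C \<and> ?A")
proof (intro iffI conjI)
  assume w: "weakly_realizes G F Or h"
  show h: ?C by (rule weakly_realizes_const_on_parts[OF Or w])
  show ?A
  proof (clarify, unfold arcs_orientation_digraph)
    fix U \<beta> a b assume "U \<in> G - F \<and> \<beta> \<in> snd (Or U)"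
      and ab: "a \<in> tail (orientation_digraph G F Or) (U, \<beta>)"
        "b \<in> head (orientation_digraph G F Or) (U, \<beta>)"
    then have U: "U \<in> G - F" "\<beta> \<in> snd (Or U)" by auto
    obtain i j where ij: "i \<in> U \<inter> \<Union>(fst (Or U))" "j \<in> U - \<Union>(fst (Or U))"
        "\<forall>a\<in>tail (orientation_digraph G F Or) (U, \<beta>). h a = h i"
        "\<forall>b\<in>head (orientation_digraph G F Or) (U, \<beta>). h b = h j"
      by (rule arrow_values[OF Or U h])
    have hab: "h a = h i" "h b = h j" using ij(3,4) ab by blast+
    have "i \<in> maximizers h U" using w ij(1) U by (auto simp: weakly_realizes_def)
    then show "h b \<le> h a" using ij(2) hab by (simp add: maximizers_def)
  qed
next
  assume "?C \<and> ?A"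
  then have h: ?C and A: ?A by blast+
  show "weakly_realizes G F Or h"
    unfolding weakly_realizes_def
  proof (intro conjI ballI subsetI)
    fix U i assume U: "U \<in> F" and i: "i \<in> U"
    have "h j \<le> h i" if "j \<in> U" for j
      by (rule eq_refl[OF const_on_parts_imp(1)[OF F Or h U that i]])
    then show "i \<in> maximizers h U" using i by (simp add: maximizers_def)
  next
    fix U i assume U: "U \<in> G - F" and i: "i \<in> U \<inter> \<Union>(fst (Or U))"
    have "h j \<le> h i" if j: "j \<in> U" for j
    proof (cases "j \<in> \<Union>(fst (Or U))")
      case True
      then show ?thesis using const_on_parts_imp(2)[OF F Or h U, of j i] i by simp
    next
      case False
      with j obtain \<beta> where "\<beta> \<in> snd (Or U)" "j \<in> head (orientation_digraph G F Or) (U, \<beta>)"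
        using tail_block_arrow[OF Or U] by blast
      moreover have "i \<in> tail (orientation_digraph G F Or) (U, \<beta>)"
        using i tail_orientation_digraph(2)[OF Or U] by blast
      ultimately show ?thesis using A U arcs_orientation_digraph by blast
    qed
    then show "i \<in> maximizers h U" using i by (simp add: maximizers_def)
  qed
qed

lemma realizes_iff_arrows:
  assumes F: "\<forall>U\<in>F. U \<noteq> {}" and Or: "Or \<in> orientations G F"
  shows "realizes G F Or h \<longleftrightarrow>
    (\<forall>p\<in>parts G F Or. \<forall>a\<in>p. \<forall>b\<in>p. h a = h b) \<and>
    (\<forall>e\<in>arcs (orientation_digraph G F Or).
      \<forall>a\<in>tail (orientation_digraph G F Or) e. \<forall>b\<in>head (orientation_digraph G F Or) e. h a > h b)"
    (is "_ \<longleftrightarrow> ?C \<and> ?A")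
proof (intro iffI conjI)
  assume r: "realizes G F Or h"
  show h: ?C by (rule weakly_realizes_const_on_parts[OF Or realizes_imp_weakly_realizes[OF r]])
  show ?A
  proof (clarify, unfold arcs_orientation_digraph)
    fix U \<beta> a b assume "U \<in> G - F \<and> \<beta> \<in> snd (Or U)"
      and ab: "a \<in> tail (orientation_digraph G F Or) (U, \<beta>)"
        "b \<in> head (orientation_digraph G F Or) (U, \<beta>)"
    then have U: "U \<in> G - F" "\<beta> \<in> snd (Or U)" by auto
    obtain i j where ij: "i \<in> U \<inter> \<Union>(fst (Or U))" "j \<in> U - \<Union>(fst (Or U))"
        "\<forall>a\<in>tail (orientation_digraph G F Or) (U, \<beta>). h a = h i"
        "\<forall>b\<in>head (orientation_digraph G F Or) (U, \<beta>). h b = h j"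
      by (rule arrow_values[OF Or U h])
    have hab: "h a = h i" "h b = h j" using ij(3,4) ab by blast+
    have "maximizers h U = U \<inter> \<Union>(fst (Or U))" using r U by (simp add: realizes_def)
    with ij(1,2) have "i \<in> maximizers h U" "j \<in> U" "j \<notin> maximizers h U" by blast+
    then have "h j < h i" by (force simp: maximizers_def)
    then show "h b < h a" using hab by simp
  qed
next
  assume CA: "?C \<and> ?A"
  then have "weakly_realizes G F Or h"
    unfolding weakly_realizes_iff_arrows[OF F Or] by (blast intro: less_imp_le)
  moreover have "maximizers h U \<subseteq> \<Union>(fst (Or U))" if U: "U \<in> G - F" for U
  proof (rule subsetI, rule ccontr)
    \<comment> \<open>Here strictness enters: a maximizer \<open>j\<close> outside the head would
      lie at the end of an arrow whose source part contains some \<open>i\<close> in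
      \<open>U\<close>, forcing \<open>h j < h i\<close>.\<close>
    fix j assume j: "j \<in> maximizers h U" "j \<notin> \<Union>(fst (Or U))"
    then have jU: "j \<in> U - \<Union>(fst (Or U))" by (simp add: maximizers_def)
    then obtain \<beta> where \<beta>: "\<beta> \<in> snd (Or U)" "j \<in> head (orientation_digraph G F Or) (U, \<beta>)"
      using tail_block_arrow[OF Or U] by blast
    obtain \<gamma> where "\<gamma> \<in> fst (Or U)" using orientationsD(1)[OF Or U] by blast
    moreover from this have "\<gamma> \<inter> U \<noteq> {}"
      using orientationsD(4)[OF Or U] by (auto simp: contract_edge_def)
    ultimately obtain i where i: "i \<in> U" "i \<in> tail (orientation_digraph G F Or) (U, \<beta>)"
      using tail_orientation_digraph(2)[OF Or U] by blast
    have "(U, \<beta>) \<in> arcs (orientation_digraph G F Or)"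
      using U \<beta>(1) by (simp add: arcs_orientation_digraph)
    from CA[THEN conjunct2, rule_format, OF this i(2) \<beta>(2)] have "h j < h i" .
    moreover have "h i \<le> h j" using j(1) i(1) by (simp add: maximizers_def)
    ultimately show False by simp
  qed
  ultimately show "realizes G F Or h"
    unfolding realizes_def weakly_realizes_def
    by (intro conjI ballI equalityI maximizers_subset Int_greatest) simp_all
qed

section \<open>Acyclicity and height functions\<close>

text \<open>A pair \<open>(u, u)\<close> in the transitive closure is a nonempty closed walk, and
  every such walk contains a cycle. The relational form is the one suited to ranking.\<close>

lemma (in wf_digraph) acyclic_arcs_ends_iff: "acyclic (arcs_ends G) \<longleftrightarrow> (\<nexists>c. cycle c)"
proof -
  have "\<not> acyclic (arcs_ends G) \<longleftrightarrow> (\<exists>c. closed_w c)"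
    unfolding acyclic_def closed_w_def using reachable1_awalk by auto
  also have "\<dots> \<longleftrightarrow> (\<exists>c. cycle c)"
    using closed_w_imp_cycle cycle_altdef by blast
  finally show ?thesis by blast
qed

text \<open>Everything reachable from \<open>q\<close> in at least one step is so reachable from
  \<open>p\<close>, while \<open>q\<close> itself is reachable from \<open>p\<close> but, by
  acyclicity, not from \<open>q\<close>.\<close>

lemma finite_acyclic_rank:
  fixes R :: "('a::finite \<times> 'a) set"
  assumes "acyclic R" "(p, q) \<in> R"
  shows "card (R\<^sup>+ `` {q}) < card (R\<^sup>+ `` {p})"
proof (rule psubset_card_mono)
  have "q \<in> R\<^sup>+ `` {p}" "q \<notin> R\<^sup>+ `` {q}" using assms by (auto simp: acyclic_def)
  moreover have "R\<^sup>+ `` {q} \<subseteq> R\<^sup>+ `` {p}" using assms(2) by (auto intro: trancl_into_trancl2)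
  ultimately show "R\<^sup>+ `` {q} \<subset> R\<^sup>+ `` {p}" by blast
qed simp

text \<open>By \<open>realizes_iff_arrows\<close>, a realizing function is constant on parts and
  strictly decreases along arrows. Such a function excludes cycles, and a reachability count
  provides one when there are none.\<close>

lemma acyclic_iff_realizable:
  fixes G :: "'n::finite set set"
  assumes F: "\<forall>U\<in>F. U \<noteq> {}" and Or: "Or \<in> orientations G F"
  shows "(\<nexists>c. pre_digraph.cycle (orientation_digraph G F Or) c) \<longleftrightarrow> (\<exists>h. realizes G F Or h)"
proof -
  let ?D = "orientation_digraph G F Or"
  let ?R = "arcs_ends ?D"
  have part: "\<exists>!p. p \<in> parts G F Or \<and> i \<in> p" for i
    using part_containing_ex1[OF partition_on_parts[of G F Or], of "{i}"]
      partition_onD1[OF partition_on_parts[of G F Or]] by auto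
  have ends: "tail ?D e \<in> parts G F Or" "head ?D e \<in> parts G F Or" if "e \<in> arcs ?D" for e
    using wf_digraph.wellformed[OF wf_orientation_digraph[OF Or] that]
    by (simp_all add: orientation_digraph_def)
  have "acyclic ?R \<longleftrightarrow> (\<exists>h. realizes G F Or h)"
  proof
    assume acyc: "acyclic ?R"
    \<comment> \<open>The height of a vertex is the number of parts reachable from its own part in
      at least one step.\<close>
    define h where "h i = real (card (?R\<^sup>+ `` {THE p. p \<in> parts G F Or \<and> i \<in> p}))" for i
    have h: "h i = real (card (?R\<^sup>+ `` {p}))" if "p \<in> parts G F Or" "i \<in> p" for i p
      using the1_equality[OF part, of p i] that by (simp add: h_def)
    have "realizes G F Or h"
      unfolding realizes_iff_arrows[OF F Or]
    proof (intro conjI ballI)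
      fix e a b assume e: "e \<in> arcs ?D" and "a \<in> tail ?D e" "b \<in> head ?D e"
      moreover have "(tail ?D e, head ?D e) \<in> ?R" using e by (auto simp: arcs_ends_conv)
      ultimately show "h b < h a"
        using finite_acyclic_rank[OF acyc] ends[OF e] by (simp add: h)
    qed (simp add: h)
    then show "\<exists>h. realizes G F Or h" by blast
  next
    assume "\<exists>h. realizes G F Or h"
    then obtain h where "realizes G F Or h" by blast
    then have h: "\<forall>e\<in>arcs ?D. \<forall>a\<in>tail ?D e. \<forall>b\<in>head ?D e. h a > h b"
      unfolding realizes_iff_arrows[OF F Or] by (rule conjunct2)
    have ne: "(SOME i. i \<in> p) \<in> p" if "p \<in> parts G F Or" for p
      using that partition_onD3[OF partition_on_parts[of G F Or]] by (metis some_in_eq)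
    show "acyclic ?R"
    proof (rule acyclicI_order[where f = "\<lambda>p. h (SOME i. i \<in> p)"])
      fix p q assume "(p, q) \<in> ?R"
      then obtain e where e: "e \<in> arcs ?D" "p = tail ?D e" "q = head ?D e"
        by (auto simp: arcs_ends_conv)
      then show "h (SOME i. i \<in> q) < h (SOME i. i \<in> p)"
        using h[rule_format, OF e(1) ne[OF ends(1)[OF e(1)]] ne[OF ends(2)[OF e(1)]]] by simp
    qed
  qed
  then show ?thesis
    using wf_digraph.acyclic_arcs_ends_iff[OF wf_orientation_digraph[OF Or]] by simp
qed

section \<open>Argmax data and pairs in \<open>AO\<close>\<close>

text \<open>From here on acyclicity enters only through the existence of a realizing
  function.\<close>

lemma AO_iff_realizable:
  fixes G :: "'n::finite set set"
  assumes "hypergraph G"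
  shows "(F, Or) \<in> AO G \<longleftrightarrow>
    F \<in> Flats G \<and> Or \<in> orientations G F \<and> (\<exists>h. realizes G F Or h)"
proof -
  have "\<forall>U\<in>F. U \<noteq> {}" if "F \<in> Flats G"
    using that assms by (force simp: Flats_def hrestrict_def hypergraph_def)
  then show ?thesis
    using acyclic_iff_realizable[of F Or G] by (auto simp: AO_def acyclic_orientations_def)
qed

text \<open>The level sets of \<open>h\<close>, listed in an arbitrary order, form a set
  composition, and a hyperedge lies inside a level set exactly when \<open>h\<close> is constant on
  it.\<close>

lemma level_flat:
  fixes G :: "'n::finite set set"
  assumes "hypergraph G"
  shows "{U \<in> G. maximizers h U = U} \<in> Flats G"
proof -
  let ?Q = "range (\<lambda>i. {j. h j = h i})"
  obtain A where A: "set A = ?Q" "distinct A" using finite_distinct_list[of ?Q] by auto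
  then have "set_composition A" by (simp add: set_composition_def partition_on_fibers)
  moreover have "{U \<in> G. maximizers h U = U} = (\<Union>K\<in>set A. hrestrict G K)"
  proof -
    have "maximizers h U = U \<longleftrightarrow> (\<exists>i. U \<subseteq> {j. h j = h i})" if "U \<in> G" for U
    proof -
      have "U \<noteq> {}" using assms that by (force simp: hypergraph_def)
      then obtain i where "i \<in> U" by blast
      then show ?thesis unfolding maximizers_eq_self_iff by (auto simp: subset_iff)
    qed
    then show ?thesis by (auto simp: A(1) hrestrict_def)
  qed
  ultimately show ?thesis by (auto simp: Flats_def)
qed

text \<open>Acyclicity takes no separate argument: \<open>h\<close> realizes the pair read off from
  its argmax sets, so \<open>AO_iff_realizable\<close> applies.\<close>

lemma exists_realized:
  fixes G :: "'n::finite set set"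
  assumes G: "hypergraph G"
  obtains F Or where "(F, Or) \<in> AO G" "realizes G F Or h"
proof -
  define F where "F = {U \<in> G. maximizers h U = U}"
  define Or where "Or = (\<lambda>U\<in>G - F. ({\<beta> \<in> contract_edge F U. \<beta> \<inter> maximizers h U \<noteq> {}},
    {\<beta> \<in> contract_edge F U. \<beta> \<inter> maximizers h U = {}}))"
  have edge: "h i = h j" if "U \<in> F" "i \<in> U" "j \<in> U" for U i j
  proof -
    have "maximizers h U = U" using that(1) by (simp add: F_def)
    then show ?thesis unfolding maximizers_eq_self_iff using that(2,3) by blast
  qed
  have const: "h i = h j" if "\<beta> \<in> hcomponents F" "i \<in> \<beta>" "j \<in> \<beta>" for \<beta> i j
    by (rule const_on_hcomponent[OF edge that])
  \<comment> \<open>As \<open>h\<close> is constant on a block, a block containing one maximizer of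
    \<open>U\<close> meets \<open>U\<close> in maximizers only; so the blocks split cleanly into two
    sides.\<close>
  have max_iff: "i \<in> maximizers h U \<longleftrightarrow> \<beta> \<inter> maximizers h U \<noteq> {}"
    if "\<beta> \<in> hcomponents F" "i \<in> \<beta>" "i \<in> U" for \<beta> i U
  proof
    assume "\<beta> \<inter> maximizers h U \<noteq> {}"
    then obtain k where "k \<in> \<beta>" "k \<in> maximizers h U" by blast
    moreover from this have "h i = h k" using const[OF that(1,2)] by simp
    ultimately show "i \<in> maximizers h U" using that(3) by (simp add: maximizers_def)
  qed (use that(2) in blast)
  have ne: "maximizers h U \<noteq> {}" if "U \<in> G" for U
    using that G by (intro maximizers_nonempty) (auto simp: hypergraph_def)
  have Or: "Or \<in> orientations G F"
    unfolding orientations_def Or_def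
  proof (rule restrict_PiE_iff[THEN iffD2], intro ballI)
    fix U assume U: "U \<in> G - F"
    have sub: "maximizers h U \<subseteq> U" by (rule maximizers_subset)
    obtain i where i: "i \<in> maximizers h U" using ne U by blast
    \<comment> \<open>Since \<open>U\<close> is outside \<open>F\<close>, some vertex
      \<open>j\<close> is not a maximizer; its block makes the second side nonempty.\<close>
    have "maximizers h U \<noteq> U" using U by (simp add: F_def)
    then obtain j where j: "j \<in> U" "j \<notin> maximizers h U" using sub by blast
    have "i \<in> \<Union>(contract_edge F U)" "j \<in> \<Union>(contract_edge F U)"
      using contract_edge_cover[of U F] i j(1) sub by auto
    then obtain \<beta> \<gamma> where "\<beta> \<in> contract_edge F U" "i \<in> \<beta>"
      and "\<gamma> \<in> contract_edge F U" "j \<in> \<gamma>" by blast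
    moreover from this have "\<gamma> \<inter> maximizers h U = {}"
      using max_iff[of \<gamma> j U] j by (simp add: contract_edge_def)
    ultimately show "({\<beta> \<in> contract_edge F U. \<beta> \<inter> maximizers h U \<noteq> {}},
        {\<beta> \<in> contract_edge F U. \<beta> \<inter> maximizers h U = {}})
      \<in> {(a, b). a \<noteq> {} \<and> b \<noteq> {} \<and> a \<inter> b = {} \<and> a \<union> b = contract_edge F U}"
      using i by auto
  qed
  have "maximizers h U = U \<inter> \<Union>(fst (Or U))" if U: "U \<in> G - F" for U
  proof -
    have "i \<in> maximizers h U \<longleftrightarrow> i \<in> \<Union>(fst (Or U))" if "i \<in> U" for i
    proof -
      have fst: "fst (Or U) = {\<beta> \<in> contract_edge F U. \<beta> \<inter> maximizers h U \<noteq> {}}"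
        using U by (simp add: Or_def)
      have "i \<in> maximizers h U" if "\<beta> \<in> fst (Or U)" "i \<in> \<beta>" for \<beta>
        using that max_iff[of \<beta> i U] \<open>i \<in> U\<close> by (simp add: fst contract_edge_def)
      moreover have "i \<in> \<Union>(contract_edge F U)"
        using contract_edge_cover[of U F] \<open>i \<in> U\<close> by auto
      then have "i \<in> maximizers h U \<Longrightarrow> i \<in> \<Union>(fst (Or U))" unfolding fst by blast
      ultimately show ?thesis by blast
    qed
    then show ?thesis using maximizers_subset[of h U] by blast
  qed
  then have "realizes G F Or h" by (simp add: realizes_def F_def)
  moreover have "F \<in> Flats G" unfolding F_def by (rule level_flat[OF G])
  ultimately show thesis using that AO_iff_realizable[OF G] Or by blast
qed

text \<open>The argmax sets determine the pair: \<open>F\<close> consists of the hyperedges equal to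
  their own argmax set, \<open>head_eq_blocks_meeting\<close> recovers each head, and the other side
  is its complement in the contracted hyperedge.\<close>

lemma realizes_unique:
  assumes G: "hypergraph G" and AO: "(F, Or) \<in> AO G" "(F', Or') \<in> AO G"
    and r: "realizes G F Or h" "realizes G F' Or' h'"
    and eq: "\<And>U. U \<in> G \<Longrightarrow> maximizers h U = maximizers h' U"
  shows "F = F'" "Or = Or'"
proof -
  have F_eq: "F = {U \<in> G. maximizers h U = U}" if "(F, Or) \<in> AO G" "realizes G F Or h" for F Or h
  proof -
    have sub: "F \<subseteq> G" using that(1) by (auto simp: AO_def Flats_def hrestrict_def)
    have Or: "Or \<in> orientations G F"
      using that(1) by (simp add: AO_def acyclic_orientations_def)
    \<comment> \<open>Outside \<open>F\<close> the second side is nonempty, and each of its blocks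
      contains a vertex of \<open>U\<close> not covered by the head, so the argmax set is
      proper.\<close>
    have "maximizers h U \<noteq> U" if U: "U \<in> G - F" for U
    proof -
      obtain \<beta> where \<beta>: "\<beta> \<in> snd (Or U)" using orientationsD(2)[OF Or U] by blast
      obtain j where "j \<in> U - \<Union>(fst (Or U))"
        by (rule arrow_values[OF Or U \<beta>
              weakly_realizes_const_on_parts[OF Or realizes_imp_weakly_realizes[OF \<open>realizes G F Or h\<close>]]])
      moreover have "maximizers h U = U \<inter> \<Union>(fst (Or U))"
        using U \<open>realizes G F Or h\<close> by (simp add: realizes_def)
      ultimately show ?thesis by blast
    qed
    moreover have "maximizers h U = U" if "U \<in> F" for U
      using \<open>realizes G F Or h\<close> that by (simp add: realizes_def)
    ultimately show ?thesis using sub by blast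
  qed
  show F: "F = F'" using F_eq[OF AO(1) r(1)] F_eq[OF AO(2) r(2)] eq by auto
  have Or: "Or \<in> orientations G F" "Or' \<in> orientations G F"
    using AO F by (simp_all add: AO_def acyclic_orientations_def)
  have "Or U = Or' U" if U: "U \<in> G - F" for U
  proof (rule prod_eqI)
    have M: "maximizers h U = U \<inter> \<Union>(fst (Or U))" "maximizers h U = U \<inter> \<Union>(fst (Or' U))"
      using r U F eq[of U] by (auto simp: realizes_def)
    show fst: "fst (Or U) = fst (Or' U)"
      using head_eq_blocks_meeting[OF Or(1) U M(1)] head_eq_blocks_meeting[OF Or(2) U M(2)]
      by simp
    show "snd (Or U) = snd (Or' U)"
      using orientationsD(3,4)[OF Or(1) U] orientationsD(3,4)[OF Or(2) U] fst by blast
  qed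
  then show "Or = Or'"
    using Or unfolding orientations_def by (intro PiE_ext)
qed

section \<open>Comparison of normal cones and orientation cones\<close>

text \<open>Membership in the cone is weak realization. The realizing \<open>h\<close> lets
  \<open>maximizers h U\<close> stand both for \<open>U\<close> itself, if \<open>U \<in> F\<close>,
  and for the vertices covered by the head otherwise, which gives the criterion for inclusion of
  faces.\<close>

lemma mem_orientation_cone_iff:
  assumes "hypergraph G" "(F, Or) \<in> AO G" "realizes G F Or h"
  shows "y \<in> orientation_cone G F Or \<longleftrightarrow>
    linear y \<and> (\<forall>U\<in>G. maximizers h U \<subseteq> maximizers (\<lambda>i. y (axis i 1)) U)"
proof -
  have F: "F \<subseteq> G" using assms(2) by (auto simp: AO_def Flats_def hrestrict_def)
  then have ne: "\<forall>U\<in>F. U \<noteq> {}" using assms(1) by (force simp: hypergraph_def)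
  have Or: "Or \<in> orientations G F"
    using assms(2) by (simp add: AO_def acyclic_orientations_def)
  have "y \<in> orientation_cone G F Or \<longleftrightarrow> linear y \<and> weakly_realizes G F Or (\<lambda>i. y (axis i 1))"
    unfolding orientation_cone_def weakly_realizes_iff_arrows[OF ne Or] by simp
  also have "weakly_realizes G F Or (\<lambda>i. y (axis i 1)) \<longleftrightarrow>
      (\<forall>U\<in>F \<union> (G - F). maximizers h U \<subseteq> maximizers (\<lambda>i. y (axis i 1)) U)"
    using assms(3) by (simp add: weakly_realizes_def realizes_def ball_Un del: Un_Diff_cancel)
  also have "F \<union> (G - F) = G" using F by blast
  finally show ?thesis .
qed

theorem theorem2p18:
  fixes G :: "'n::finite set set"
  assumes "hypergraph G"
  shows "normal_fan (hypergraphic_polytope G) = (\<lambda>(F, Or). orientation_cone G F Or) ` AO G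
    \<and> inj_on (\<lambda>(F, Or). orientation_cone G F Or) (AO G)
    \<and> (\<forall>(F, Or)\<in>AO G. \<exists>!f. f \<in> nonempty_faces (hypergraphic_polytope G) \<and>
           normal_cone (hypergraphic_polytope G) f = orientation_cone G F Or)
    \<and> bij_betw
           (\<lambda>(F, Or). THE f. f \<in> nonempty_faces (hypergraphic_polytope G) \<and>
              normal_cone (hypergraphic_polytope G) f = orientation_cone G F Or)
           (AO G) (nonempty_faces (hypergraphic_polytope G))"
proof -
  let ?P = "hypergraphic_polytope G"
  let ?N = "normal_cone ?P"
  let ?C = "\<lambda>(F, Or). orientation_cone G F Or"
  let ?w = "\<lambda>x i. x (axis i (1::real))"
  note P = polytope_hypergraphic[OF assms]
  have faces: "nonempty_faces ?P = {maximizers x ?P | x. linear x}"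
    by (rule nonempty_faces_polytope[OF P])
  have mem_N: "y \<in> ?N (maximizers x ?P) \<longleftrightarrow> linear y \<and> maximizers x ?P \<subseteq> maximizers y ?P"
    if "linear x" for x y
  proof (rule mem_normal_cone_maximizers)
    have "maximizers x ?P \<in> nonempty_faces ?P" using that faces by blast
    then show "maximizers x ?P \<noteq> {}" by (simp add: nonempty_faces_def)
  qed
  \<comment> \<open>Each functional lies in the normal cone of its own face; equal cones therefore
    give inclusions of faces in both directions.\<close>
  have N_inj: "maximizers x ?P = maximizers y ?P"
    if "linear x" "linear y" "?N (maximizers x ?P) = ?N (maximizers y ?P)" for x y
  proof
    have "x \<in> ?N (maximizers y ?P)" "y \<in> ?N (maximizers x ?P)"
      using mem_N[OF that(1), of x] mem_N[OF that(2), of y] that by simp_all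
    then show "maximizers x ?P \<subseteq> maximizers y ?P" "maximizers y ?P \<subseteq> maximizers x ?P"
      using mem_N[OF that(1), of y] mem_N[OF that(2), of x] by simp_all
  qed
  \<comment> \<open>Both memberships say that the argmax sets of \<open>x\<close> on the hyperedges
    are contained in those of \<open>y\<close>.\<close>
  have N_C: "?N (maximizers x ?P) = orientation_cone G F Or"
    if "linear x" "(F, Or) \<in> AO G" "realizes G F Or (?w x)" for x F Or
  proof (rule set_eqI)
    fix y
    show "y \<in> ?N (maximizers x ?P) \<longleftrightarrow> y \<in> orientation_cone G F Or"
      unfolding mem_N[OF that(1)] mem_orientation_cone_iff[OF assms that(2,3)]
      using maximizers_hypergraphic_subset_iff[OF assms that(1)] by blast
  qed
  have realizer: "\<exists>x. linear x \<and> realizes G F Or (?w x)" if FO: "(F, Or) \<in> AO G" for F Or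
  proof -
    obtain h where h: "realizes G F Or h"
      using iffD1[OF AO_iff_realizable[OF assms] FO] by blast
    obtain x :: "real ^ 'n \<Rightarrow> real" where "linear x" "\<forall>i. x (axis i 1) = h i"
      by (rule linear_of_axis_values)
    then show ?thesis using h by (intro exI[of _ x]) simp
  qed
  have fan: "normal_fan ?P = ?C ` AO G"
  proof (intro equalityI subsetI)
    fix c assume "c \<in> normal_fan ?P"
    then obtain x where x: "linear x" "c = ?N (maximizers x ?P)"
      unfolding normal_fan_def faces by blast
    obtain F Or where "(F, Or) \<in> AO G" "realizes G F Or (?w x)"
      by (rule exists_realized[OF assms])
    then show "c \<in> ?C ` AO G" using x N_C by force
  next
    fix c assume "c \<in> ?C ` AO G"
    then obtain F Or where FO: "(F, Or) \<in> AO G" "c = orientation_cone G F Or" by auto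
    then obtain x where "linear x" "realizes G F Or (?w x)" using realizer by blast
    then show "c \<in> normal_fan ?P" using FO N_C unfolding normal_fan_def faces by blast
  qed
  have C_inj: "inj_on ?C (AO G)"
  proof (rule inj_onI, clarify)
    fix F Or F' Or'
    assume AO: "(F, Or) \<in> AO G" "(F', Or') \<in> AO G"
      and eq: "orientation_cone G F Or = orientation_cone G F' Or'"
    obtain x where x: "linear x" "realizes G F Or (?w x)" using realizer[OF AO(1)] by blast
    obtain x' where x': "linear x'" "realizes G F' Or' (?w x')" using realizer[OF AO(2)] by blast
    \<comment> \<open>Equal cones force equal faces, and equal faces force equal argmax sets on
      every hyperedge; these determine the pair.\<close>
    have "maximizers x ?P = maximizers x' ?P"
      using N_inj[OF x(1) x'(1)] N_C[OF x(1) AO(1) x(2)] N_C[OF x'(1) AO(2) x'(2)] eq by simp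
    then have "maximizers (?w x) U = maximizers (?w x') U" if "U \<in> G" for U
      using maximizers_hypergraphic_subset_iff[OF assms x(1) x'(1)]
        maximizers_hypergraphic_subset_iff[OF assms x'(1) x(1)] that by blast
    then show "F = F' \<and> Or = Or'"
      using realizes_unique[OF assms AO x(2) x'(2)] by blast
  qed
  have N_inj_on: "inj_on ?N (nonempty_faces ?P)"
    unfolding faces by (rule inj_onI) (use N_inj in blast)
  \<comment> \<open>The correspondence factors through the cones: pairs go to cones by
    \<open>?C\<close>, and cones go back to faces by inverting \<open>?N\<close>. Unfolding
    \<open>the_inv_into\<close> yields the definite description of the statement.\<close>
  have "bij_betw ?C (AO G) (?N ` nonempty_faces ?P)"
    using C_inj fan by (simp add: bij_betw_def normal_fan_def)
  moreover have "bij_betw (the_inv_into (nonempty_faces ?P) ?N)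
      (?N ` nonempty_faces ?P) (nonempty_faces ?P)"
    by (rule bij_betw_the_inv_into) (simp add: bij_betw_def N_inj_on)
  ultimately have "bij_betw (the_inv_into (nonempty_faces ?P) ?N \<circ> ?C) (AO G) (nonempty_faces ?P)"
    by (rule bij_betw_trans)
  also have "the_inv_into (nonempty_faces ?P) ?N \<circ> ?C =
      (\<lambda>(F, Or). THE f. f \<in> nonempty_faces ?P \<and> ?N f = orientation_cone G F Or)"
    by (auto simp: fun_eq_iff the_inv_into_def)
  finally have bij: "bij_betw (\<lambda>(F, Or). THE f. f \<in> nonempty_faces ?P \<and>
      ?N f = orientation_cone G F Or) (AO G) (nonempty_faces ?P)" .
  have unique: "\<exists>!f. f \<in> nonempty_faces ?P \<and> ?N f = orientation_cone G F Or"
    if "(F, Or) \<in> AO G" for F Or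
  proof -
    have "orientation_cone G F Or \<in> ?N ` nonempty_faces ?P"
      using fan that unfolding normal_fan_def by force
    then show ?thesis using N_inj_on by (auto dest: inj_onD)
  qed
  have "\<forall>(F, Or)\<in>AO G. \<exists>!f. f \<in> nonempty_faces ?P \<and> ?N f = orientation_cone G F Or"
    by (intro ballI case_prodI2) (simp only: unique)
  with fan C_inj bij show ?thesis by (intro conjI)
qed

end
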